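(* The function $(n,\tau)\mapsto\operatorname{li}(n;\tau)$ (the septic parametric logarithmic operator) possesses continuous partial derivatives up to the third order in all variables on the domain $(1,\infty)\times\mathbb{R}^+$. In particular, the mixed partial derivatives up to third order, including $\partial_\tau\partial_n\operatorname{li}$, $\partial_\tau^2\partial_n\operatorname{li}$ and $\partial_n\partial_\tau^2\operatorname{li}$, are globally continuous, including across all integer values $\tau=m\in\mathbb{N}$.
   Context: Septic parametric logarithmic operator: for real $n>1$ and a real truncation parameter $\tau\in\mathbb{R}^+$, put $k=\lfloor\tau\rfloor\in\mathbb{N}_0$ and define $$\operatorname{li}(n;\tau)=\frac{n}{\ln n}\left(\sum_{j=0}^{k-1}\frac{j!}{\ln^j n}+\phi(\tau-\lfloor\tau\rfloor)\frac{k!}{\ln^k n}\right),\qquad \phi(x)=35x^4-84x^5+70x^6-20x^7 .$$ The empty sum is $0$, so $\operatorname{li}(n;\tau)=\frac{n}{\ln n}\phi(\tau)$ for $\tau\in[0,1]$. Here $\ln^j n=(\ln n)^j$, $\partial_n=\partial/\partial n$ and $\partial_\tau=\partial/\partial\tau$, where $n$ is treated as a real variable. *)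

theory Defs
  imports "HOL-Analysis.Analysis"
begin

definition septic :: "real \<Rightarrow> real" where
  "septic x = 35 * x ^ 4 - 84 * x ^ 5 + 70 * x ^ 6 - 20 * x ^ 7"

text \<open>The septic parametric logarithmic operator, as a function of the pair \<open>(n, \<tau>)\<close>.
  It is total; only its values on \<open>n > 1\<close>, \<open>\<tau> > 0\<close> are meaningful.\<close>

definition li :: "real \<times> real \<Rightarrow> real" where
  "li = (\<lambda>(n :: real, \<tau> :: real). let k = nat \<lfloor>\<tau>\<rfloor> in
     n / ln n * ((\<Sum>j<k. fact j / ln n ^ j) + septic (\<tau> - real_of_int \<lfloor>\<tau>\<rfloor>) * (fact k / ln n ^ k)))"

datatype coord = Var_n | Var_tau

primrec partially_differentiable_at :: "coord \<Rightarrow> (real \<times> real \<Rightarrow> real) \<Rightarrow> real \<times> real \<Rightarrow> bool" where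
  "partially_differentiable_at Var_n f p \<longleftrightarrow> (\<lambda>x. f (x, snd p)) differentiable at (fst p)"
| "partially_differentiable_at Var_tau f p \<longleftrightarrow> (\<lambda>t. f (fst p, t)) differentiable at (snd p)"

text \<open>\<^const>\<open>deriv\<close> returns an unspecified value where the derivative does not exist, so
  existence has to be stated separately by \<^const>\<open>partially_differentiable_at\<close>.\<close>

primrec partial :: "coord \<Rightarrow> (real \<times> real \<Rightarrow> real) \<Rightarrow> real \<times> real \<Rightarrow> real" where
  "partial Var_n f = (\<lambda>(n, \<tau>). deriv (\<lambda>x. f (x, \<tau>)) n)"
| "partial Var_tau f = (\<lambda>(n, \<tau>). deriv (\<lambda>t. f (n, t)) \<tau>)"

text \<open>The operator word is read as on paper, the last letter acting first:
  \<open>partials [Var_tau, Var_n] f\<close> is \<open>\<partial>\<^sub>\<tau> \<partial>\<^sub>n f\<close>.\<close>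

primrec partials :: "coord list \<Rightarrow> (real \<times> real \<Rightarrow> real) \<Rightarrow> real \<times> real \<Rightarrow> real" where
  "partials [] f = f"
| "partials (v # w) f = partial v (partials w f)"

text \<open>Meant for open \<open>S\<close>: all iterated partial derivatives of order at most \<open>k\<close>, in every
  order of differentiation, exist at all points of \<open>S\<close> and are jointly continuous on \<open>S\<close>.\<close>

definition continuous_partials_upto ::
    "nat \<Rightarrow> (real \<times> real \<Rightarrow> real) \<Rightarrow> (real \<times> real) set \<Rightarrow> bool" where
  "continuous_partials_upto k f S \<longleftrightarrow>
     (\<forall>w v. length w < k \<longrightarrow> (\<forall>p\<in>S. partially_differentiable_at v (partials w f) p)) \<and>
     (\<forall>w. length w \<le> k \<longrightarrow> continuous_on S (partials w f))"

end

theory Submission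
  imports Defs
begin

text \<open>Let \<open>\<sigma>\<close> be the septic polynomial precomposed with the clamping of the real line to
  \<open>[0, 1]\<close>. Since the septic runs from \<open>0\<close> to \<open>1\<close> and its derivatives of order \<open>1\<close>, \<open>2\<close>, \<open>3\<close>
  vanish at both ends, \<open>\<sigma>\<close> is three times continuously differentiable, and for \<open>0 < \<tau> < N\<close>
  the operator is the finite sum of the separated terms
  \<open>j! n / ln\<^sup>j\<^sup>+\<^sup>1 n \<cdot> \<sigma> (\<tau> - j)\<close> with \<open>j < N\<close>, so that the floor function
  disappears. In such a sum all partial derivatives can be taken factor by factor.\<close>

text \<open>Each letter of the word differentiates just one of the two factors in every summand, so
  only the number of occurrences of each letter matters, not their order. Existence and value come
  from the same induction step, since \<open>partial\<close> is built on
  \<open>deriv\<close>.\<close>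

lemma partials_sum_of_products:
  fixes G S :: "'j \<Rightarrow> nat \<Rightarrow> real \<Rightarrow> real"
  assumes U: "open U"
    and f: "\<And>p. p \<in> U \<Longrightarrow> f p = (\<Sum>j\<in>J. G j 0 (fst p) * S j 0 (snd p))"
    and G: "\<And>j i p. j \<in> J \<Longrightarrow> i < k \<Longrightarrow> p \<in> U \<Longrightarrow>
      (G j i has_real_derivative G j (Suc i) (fst p)) (at (fst p))"
    and S: "\<And>j i p. j \<in> J \<Longrightarrow> i < k \<Longrightarrow> p \<in> U \<Longrightarrow>
      (S j i has_real_derivative S j (Suc i) (snd p)) (at (snd p))"
  shows "length w \<le> k \<Longrightarrow> p \<in> U \<Longrightarrow>
      partials w f p = (\<Sum>j\<in>J. G j (count_list w Var_n) (fst p) * S j (count_list w Var_tau) (snd p))"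
    and "length w < k \<Longrightarrow> p \<in> U \<Longrightarrow> partially_differentiable_at v (partials w f) p"
proof -
  let ?F = "\<lambda>w p. \<Sum>j\<in>J. G j (count_list w Var_n) (fst p) * S j (count_list w Var_tau) (snd p)"
  have step: "partially_differentiable_at v (partials w f) p \<and> partials (v # w) f p = ?F (v # w) p"
    if IH: "\<And>p. p \<in> U \<Longrightarrow> partials w f p = ?F w p" and w: "length w < k" and p: "p \<in> U" for v w p
  proof -
    obtain n t where nt: "p = (n, t)" by (cases p)
    have le: "count_list w c < k" for c
      using count_le_length[of w c] w by linarith
    \<comment> \<open>The formula for \<open>w\<close> is known on \<open>U\<close> only. Openness
      provides it along a whole neighbourhood on each coordinate line, as differentiation
      requires.\<close>
    have ev: "\<forall>\<^sub>F x in nhds n. (x, t) \<in> U" "\<forall>\<^sub>F s in nhds t. (n, s) \<in> U"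
    proof -
      have "open ((\<lambda>x. (x, t)) -` U)" "open ((\<lambda>s. (n, s)) -` U)"
        by (auto intro!: open_vimage U continuous_intros)
      then show "\<forall>\<^sub>F x in nhds n. (x, t) \<in> U" "\<forall>\<^sub>F s in nhds t. (n, s) \<in> U"
        using p nt by (auto simp: eventually_nhds vimage_def)
    qed
    show ?thesis
    proof (cases v)
      case Var_n
      have "((\<lambda>x. ?F w (x, t)) has_real_derivative ?F (v # w) p) (at n)"
        using G[OF _ le p] Var_n nt by (auto intro!: DERIV_sum DERIV_cmult_right)
      moreover have "\<forall>\<^sub>F x in nhds n. partials w f (x, t) = ?F w (x, t)"
        using ev(1) by eventually_elim (rule IH)
      ultimately have "((\<lambda>x. partials w f (x, t)) has_real_derivative ?F (v # w) p) (at n)"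
        by (simp add: DERIV_cong_ev[OF refl _ refl])
      then show ?thesis
        using Var_n nt by (auto simp: DERIV_imp_deriv real_differentiable_def)
    next
      case Var_tau
      have "((\<lambda>s. ?F w (n, s)) has_real_derivative ?F (v # w) p) (at t)"
        using S[OF _ le p] Var_tau nt by (auto intro!: DERIV_sum DERIV_cmult)
      moreover have "\<forall>\<^sub>F s in nhds t. partials w f (n, s) = ?F w (n, s)"
        using ev(2) by eventually_elim (rule IH)
      ultimately have "((\<lambda>s. partials w f (n, s)) has_real_derivative ?F (v # w) p) (at t)"
        by (simp add: DERIV_cong_ev[OF refl _ refl])
      then show ?thesis
        using Var_tau nt by (auto simp: DERIV_imp_deriv real_differentiable_def)
    qed
  qed
  have formula: "length w \<le> k \<Longrightarrow> p \<in> U \<Longrightarrow> partials w f p = ?F w p" for w p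
  proof (induction w arbitrary: p)
    case Nil
    then show ?case by (simp add: f)
  next
    case (Cons v w)
    then show ?case using step[of w p v] by simp
  qed
  then show "length w \<le> k \<Longrightarrow> p \<in> U \<Longrightarrow> partials w f p = ?F w p" .
  show "length w < k \<Longrightarrow> p \<in> U \<Longrightarrow> partially_differentiable_at v (partials w f) p"
    using step formula by simp
qed

lemma continuous_partials_upto_sum_of_products:
  fixes G S :: "'j \<Rightarrow> nat \<Rightarrow> real \<Rightarrow> real"
  assumes U: "open U"
    and f: "\<And>p. p \<in> U \<Longrightarrow> f p = (\<Sum>j\<in>J. G j 0 (fst p) * S j 0 (snd p))"
    and G: "\<And>j i p. j \<in> J \<Longrightarrow> i < k \<Longrightarrow> p \<in> U \<Longrightarrow>
      (G j i has_real_derivative G j (Suc i) (fst p)) (at (fst p))"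
    and S: "\<And>j i p. j \<in> J \<Longrightarrow> i < k \<Longrightarrow> p \<in> U \<Longrightarrow>
      (S j i has_real_derivative S j (Suc i) (snd p)) (at (snd p))"
    and contG: "\<And>j i. j \<in> J \<Longrightarrow> i \<le> k \<Longrightarrow> continuous_on (fst ` U) (G j i)"
    and contS: "\<And>j i. j \<in> J \<Longrightarrow> i \<le> k \<Longrightarrow> continuous_on (snd ` U) (S j i)"
  shows "continuous_partials_upto k f U"
  unfolding continuous_partials_upto_def
proof (intro conjI allI impI ballI)
  show "partially_differentiable_at v (partials w f) p" if "length w < k" "p \<in> U" for w v p
    using partials_sum_of_products(2)[where G = G and S = S and J = J, OF U f G S] that by blast
next
  fix w :: "coord list" assume w: "length w \<le> k"
  then have le: "count_list w c \<le> k" for c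
    using count_le_length[of w c] by linarith
  have "continuous_on U
      (\<lambda>p. \<Sum>j\<in>J. G j (count_list w Var_n) (fst p) * S j (count_list w Var_tau) (snd p))"
    by (intro continuous_on_sum continuous_on_mult
        continuous_on_compose2[OF contG[OF _ le] continuous_on_fst[OF continuous_on_id]]
        continuous_on_compose2[OF contS[OF _ le] continuous_on_snd[OF continuous_on_id]]) auto
  then show "continuous_on U (partials w f)"
    using partials_sum_of_products(1)[OF U f G S w] by (simp cong: continuous_on_cong)
qed

text \<open>Lets the domain be exhausted by strips with bounded \<tau>, on each of which a fixed
  finite sum represents the operator.\<close>

lemma continuous_partials_upto_UN:
  assumes "\<And>i. i \<in> I \<Longrightarrow> open (U i)" "\<And>i. i \<in> I \<Longrightarrow> continuous_partials_upto k f (U i)"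
  shows "continuous_partials_upto k f (\<Union>i\<in>I. U i)"
  using assms unfolding continuous_partials_upto_def by (auto intro!: continuous_on_open_UN)

definition clamp01 :: "real \<Rightarrow> real" where
  "clamp01 x = max 0 (min 1 x)"

text \<open>Strictly between 0 and 1 the clamping is locally the identity. Everywhere else,
  endpoints included, \<open>f'\<close> vanishes at the clamped point, and since clamping is
  1-Lipschitz, the increment of the composite is o(|y - x|).\<close>

lemma has_real_derivative_clamp01:
  fixes f f' :: "real \<Rightarrow> real"
  assumes f: "\<And>x. (f has_real_derivative f' x) (at x)"
    and ends: "f' 0 = 0" "f' 1 = 0"
  shows "((\<lambda>x. f (clamp01 x)) has_real_derivative f' (clamp01 x)) (at x)"
proof (cases "0 < x \<and> x < 1")
  case True
  then have "\<forall>\<^sub>F y in nhds x. y \<in> {0<..<1}"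
    by (intro eventually_nhds_in_open) auto
  then have "\<forall>\<^sub>F y in nhds x. f (clamp01 y) = f y"
    by eventually_elim (simp add: clamp01_def)
  then show ?thesis
    using f[of x] True by (simp add: DERIV_cong_ev[OF refl _ refl] clamp01_def)
next
  case False
  let ?c = "clamp01 x"
  have zero: "f' ?c = 0"
    using False ends by (auto simp: clamp01_def)
  have lip: "\<bar>clamp01 y - ?c\<bar> \<le> \<bar>y - x\<bar>" for y
    by (auto simp: clamp01_def)
  have "((\<lambda>x. f (clamp01 x)) has_derivative (\<lambda>_. 0)) (at x)"
    unfolding has_derivative_at_alt
  proof (intro conjI allI impI)
    fix e :: real assume e: "e > 0"
    have "(f has_derivative (\<lambda>_. 0)) (at ?c)"
      using f[of ?c] zero by (simp add: has_field_derivative_def lambda_zero)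
    then obtain d where d: "d > 0" "\<And>y. \<bar>y - ?c\<bar> < d \<Longrightarrow> \<bar>f y - f ?c\<bar> \<le> e * \<bar>y - ?c\<bar>"
      using e unfolding has_derivative_at_alt by (auto simp: real_norm_def)
    have "\<bar>f (clamp01 y) - f ?c\<bar> \<le> e * \<bar>y - x\<bar>" if "\<bar>y - x\<bar> < d" for y
      using d(2)[of "clamp01 y"] lip[of y] that e
      by (smt (verit) mult_left_mono)
    then show "\<exists>d>0. \<forall>y. norm (y - x) < d \<longrightarrow>
        norm (f (clamp01 y) - f (clamp01 x) - 0) \<le> e * norm (y - x)"
      using d(1) by auto
  qed simp
  then show ?thesis
    by (simp add: zero has_field_derivative_def lambda_zero)
qed

definition septic_poly :: "real poly" where
  "septic_poly = [:0, 0, 0, 0, 35, -84, 70, -20:]"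

text \<open>Differentiation precedes clamping. For \<open>i\<close> up to 3 this is the
  \<open>i\<close>-th derivative of \<open>septic_step 0\<close>.\<close>

definition septic_step :: "nat \<Rightarrow> real \<Rightarrow> real" where
  "septic_step i x = poly ((pderiv ^^ i) septic_poly) (clamp01 x)"

lemma septic_step_0: "septic_step 0 x = (if x \<le> 0 then 0 else if x \<ge> 1 then 1 else septic x)"
proof -
  have "poly septic_poly y = septic y" for y
    by (simp add: septic_poly_def septic_def algebra_simps power_numeral_reduce)
  then show ?thesis
    by (simp add: septic_step_def clamp01_def septic_def)
qed

text \<open>The derivative of the septic is 140 x^3 (1 - x)^3, with triple zeros at 0 and 1; hence
  the bound 3.\<close>

lemma septic_step_has_derivative:
  assumes "i < 3"
  shows "(septic_step i has_real_derivative septic_step (Suc i) x) (at x)"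
proof -
  have "poly ((pderiv ^^ Suc i) septic_poly) 0 = 0 \<and> poly ((pderiv ^^ Suc i) septic_poly) 1 = 0"
    using assms
    by (auto simp: septic_poly_def less_Suc_eq numeral_eq_Suc pderiv_pCons)
  moreover have "(poly ((pderiv ^^ i) septic_poly) has_real_derivative
      poly ((pderiv ^^ Suc i) septic_poly) x) (at x)" for x
    using poly_DERIV[of "(pderiv ^^ i) septic_poly"] by simp
  ultimately show ?thesis
    unfolding septic_step_def by (intro has_real_derivative_clamp01) auto
qed

lemma continuous_on_septic_step: "continuous_on A (septic_step i)"
  unfolding septic_step_def clamp01_def by (intro continuous_intros)

text \<open>The factors depending on \<open>n\<close> and their derivatives have the form \<open>n\<^sup>1\<^sup>-\<^sup>i Q(1 / ln n)\<close>;
  the recursion for \<open>Q\<close> is the product rule, with \<open>u' = - u\<^sup>2 / n\<close> for \<open>u = 1 / ln n\<close>.\<close>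

primrec log_poly :: "nat \<Rightarrow> nat \<Rightarrow> real poly" where
  "log_poly j 0 = monom (fact j) (Suc j)"
| "log_poly j (Suc i) = smult (1 - real i) (log_poly j i) - [:0, 0, 1:] * pderiv (log_poly j i)"

definition log_term :: "nat \<Rightarrow> nat \<Rightarrow> real \<Rightarrow> real" where
  "log_term j i n = n powi (1 - int i) * poly (log_poly j i) (1 / ln n)"

lemma log_term_0: "log_term j 0 n = n / ln n * (fact j / ln n ^ j)"
  by (simp add: log_term_def poly_monom power_one_over field_simps)

lemma log_term_has_derivative:
  assumes n: "n > 1"
  shows "(log_term j i has_real_derivative log_term j (Suc i) n) (at n)"
proof -
  let ?Q = "log_poly j i"
  let ?u = "1 / ln n"
  have u: "((\<lambda>n. 1 / ln n) has_real_derivative - (?u ^ 2) / n) (at n)"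
    using n by (auto intro!: derivative_eq_intros simp: power2_eq_square field_simps)
  have Q: "((\<lambda>n. poly ?Q (1 / ln n)) has_real_derivative
      poly (pderiv ?Q) ?u * (- (?u ^ 2) / n)) (at n)"
    by (rule DERIV_chain2[OF poly_DERIV u])
  have P: "((\<lambda>n. n powi (1 - int i)) has_real_derivative
      of_int (1 - int i) * n powi (1 - int i - 1)) (at n)"
    using n DERIV_power_int[OF DERIV_ident, where n = "1 - int i" and x = n and s = UNIV] by simp
  \<comment> \<open>The extra factor n cancels the 1/n in the derivative of 1 / ln n, leaving the
    exponent that belongs to \<open>Suc i\<close>.\<close>
  have pow: "n powi (1 - int i) = n * n powi (- int i)"
    using n power_int_add[of n 1 "- int i"] by simp
  have "log_term j (Suc i) n = of_int (1 - int i) * n powi (1 - int i - 1) * poly ?Q ?u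
      + poly (pderiv ?Q) ?u * (- (?u ^ 2) / n) * n powi (1 - int i)"
    using n by (simp add: log_term_def pow algebra_simps power2_eq_square)
  then show ?thesis
    unfolding log_term_def[of j i, abs_def] using DERIV_mult[OF P Q] by simp
qed

text \<open>With k the floor of t, the step factor is 1 for j < k, the septic of the fractional part
  for j = k, and 0 for j > k. As \<open>N\<close> need not depend on t, one formula serves on both
  sides of every integer below \<open>N\<close>.\<close>

lemma li_eq_sum:
  assumes t: "0 < t" "t < real N"
  shows "li (n, t) = (\<Sum>j<N. log_term j 0 n * septic_step 0 (t - real j))"
proof -
  define k where "k = nat \<lfloor>t\<rfloor>"
  have fl: "\<lfloor>t\<rfloor> = int k" using t by (simp add: k_def)
  then have k: "real k \<le> t" "t < real k + 1" by linarith+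
  then have "k < N" using t by linarith
  have "(\<Sum>j<N. log_term j 0 n * septic_step 0 (t - real j))
      = (\<Sum>j<Suc k. log_term j 0 n * septic_step 0 (t - real j))"
    using \<open>k < N\<close> k by (intro sum.mono_neutral_right) (auto simp: septic_step_0)
  also have "\<dots> = (\<Sum>j<k. log_term j 0 n) + log_term k 0 n * septic (t - real k)"
  proof -
    have "(\<Sum>j<k. log_term j 0 n * septic_step 0 (t - real j)) = (\<Sum>j<k. log_term j 0 n)"
      using k by (intro sum.cong) (auto simp: septic_step_0)
    \<comment> \<open>For integer t the argument is 0 and falls into the first branch, which agrees
      because the septic vanishes at 0.\<close>
    moreover have "septic_step 0 (t - real k) = septic (t - real k)"
      using k by (auto simp: septic_step_0 septic_def)
    ultimately show ?thesis by simp
  qed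
  also have "\<dots> = li (n, t)"
    by (simp add: li_def fl log_term_0 sum_distrib_left distrib_left)
  finally show ?thesis by simp
qed

lemma continuous_partials_upto_li: "continuous_partials_upto 3 li ({1<..} \<times> {0<..})"
proof -
  have "continuous_partials_upto 3 li ({1<..} \<times> {0<..<real N})" for N
  proof (rule continuous_partials_upto_sum_of_products
      [where J = "{..<N}" and G = log_term and S = "\<lambda>j i t. septic_step i (t - real j)"])
    show "open ({1<..} \<times> {0<..<real N} :: (real \<times> real) set)"
      by (intro open_Times) auto
    show "li p = (\<Sum>j<N. log_term j 0 (fst p) * septic_step 0 (snd p - real j))"
      if "p \<in> {1<..} \<times> {0<..<real N}" for p
      using that li_eq_sum by auto
    show "(log_term j i has_real_derivative log_term j (Suc i) (fst p)) (at (fst p))"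
      if "p \<in> {1<..} \<times> {0<..<real N}" for p j i
      using that log_term_has_derivative by auto
    show "((\<lambda>t. septic_step i (t - real j)) has_real_derivative
        septic_step (Suc i) (snd p - real j)) (at (snd p))"
      if "i < 3" for p :: "real \<times> real" and j i
    proof -
      have "((\<lambda>t. t - real j) has_real_derivative 1) (at (snd p))"
        by (auto intro!: derivative_eq_intros)
      from DERIV_chain2[OF septic_step_has_derivative[OF that] this] show ?thesis
        by simp
    qed
    \<comment> \<open>\<open>log_term_has_derivative\<close> holds for every order, so it also
      yields continuity at order 3. For \<open>septic_step\<close> that route stops at order 2, so
      continuity comes from polynomials and clamping.\<close>
    show "continuous_on (fst ` ({1<..} \<times> {0<..<real N})) (log_term j i)" for j i
      by (rule continuous_at_imp_continuous_on)
        (auto intro: DERIV_isCont[OF log_term_has_derivative])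
    show "continuous_on (snd ` ({1<..} \<times> {0<..<real N})) (\<lambda>t. septic_step i (t - real j))" for j i
      by (intro continuous_on_compose2[OF continuous_on_septic_step[of UNIV]] continuous_intros) auto
  qed
  then have "continuous_partials_upto 3 li (\<Union>N. {1<..} \<times> {0<..<real N})"
    by (intro continuous_partials_upto_UN open_Times) auto
  also have "(\<Union>N. {1<..} \<times> {0<..<real N}) = {1<..} \<times> {0<..}"
    using reals_Archimedean2 by fastforce
  finally show ?thesis .
qed

theorem theorem2p3:
  "continuous_partials_upto 3 li ({1<..} \<times> {0<..}) \<and>
   (\<forall>w. length w \<le> 3 \<and> set w = {Var_n, Var_tau} \<longrightarrow>
      continuous_on ({1<..} \<times> {0<..}) (partials w li) \<and>
      (\<forall>n>1. \<forall>m::nat. m > 0 \<longrightarrow> isCont (partials w li) (n, real m))) \<and>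
   continuous_on ({1<..} \<times> {0<..}) (partials [Var_tau, Var_n] li) \<and>
   continuous_on ({1<..} \<times> {0<..}) (partials [Var_tau, Var_tau, Var_n] li) \<and>
   continuous_on ({1<..} \<times> {0<..}) (partials [Var_n, Var_tau, Var_tau] li)"
proof -
  have cont: "continuous_on ({1<..} \<times> {0<..}) (partials w li)" if "length w \<le> 3" for w
    using continuous_partials_upto_li that unfolding continuous_partials_upto_def by blast
  \<comment> \<open>On an open set, continuity on the set is continuity at each of its points, in
    particular at \<tau> = m.\<close>
  have "open ({1<..} \<times> {0<..} :: (real \<times> real) set)"
    by (intro open_Times) auto
  then have "isCont (partials w li) (n, real m)" if "length w \<le> 3" "n > 1" "m > 0" for w n m
    using that cont[of w] by (simp add: continuous_on_eq_continuous_at)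
  then show ?thesis
    using continuous_partials_upto_li cont by (simp del: partials.simps)
qed

end
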